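(* There is a weak P-point in the Stone space $\mathrm{St}(\mathbb{B})$ of the measure algebra $\mathbb{B}$.
   Context: $\mathbb{B}=\mathrm{Bor}(2^\omega)/\mathcal{N}$ is the measure algebra, i.e. the Boolean algebra of Borel subsets of $2^\omega$ modulo the $\sigma$-ideal $\mathcal{N}$ of Lebesgue (Haar) measure zero sets. $\mathrm{St}(\mathbb{B})$ is the compact Hausdorff space of ultrafilters on $\mathbb{B}$. A point $p$ of a space $X$ is a weak P-point if $p\notin\overline{C}$ for every countable $C\subseteq X\setminus\{p\}$. *)

theory Defs
  imports "HOL-Probability.Probability"
begin

section \<open>The Cantor space and its Haar measure\<close>

text \<open>
  The Cantor space is the type \<^typ>\<open>nat \<Rightarrow> bool\<close> with the product topology of the library;
  the following instance makes its Borel sets coincide with the product of the discrete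
  sigma-algebras.
\<close>

instance bool :: second_countable_topology
proof
  show "\<exists>B::bool set set. countable B \<and> open = generate_topology B"
  proof (intro exI conjI)
    show "countable (UNIV :: bool set set)" by (rule countable_finite) simp
    show "open = generate_topology (UNIV :: bool set set)"
      by (auto simp: fun_eq_iff discrete_topology_class.open_discrete intro: generate_topology.Basis)
  qed
qed

text \<open>
  The Haar (Lebesgue) probability measure is the countable power of the fair coin measure.
\<close>

definition haar :: "(nat \<Rightarrow> bool) measure" where
  "haar = (\<Pi>\<^sub>M i\<in>UNIV. uniform_count_measure (UNIV :: bool set))"

lemma sets_haar [measurable_cong]: "sets haar = sets borel"
proof -
  have "A \<in> sets borel" for A :: "bool set"
    by (rule borel_open[OF discrete_topology_class.open_discrete])
  then have "sets (borel :: bool measure) = UNIV" by blast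
  then have "sets haar = sets (\<Pi>\<^sub>M i\<in>UNIV. borel :: bool measure)"
    unfolding haar_def by (intro sets_PiM_cong) (auto simp: sets_uniform_count_measure)
  also have "\<dots> = sets borel" by (rule sets_PiM_equal_borel)
  finally show ?thesis .
qed

lemma space_haar [simp]: "space haar = UNIV"
  using sets_eq_imp_space_eq[OF sets_haar] by simp

lemma emeasure_haar_cylinder:
  assumes "finite J"
  shows "emeasure haar {x. \<forall>i\<in>J. x i = s i} = ennreal ((1/2) ^ card J)"
proof -
  interpret product_prob_space "\<lambda>i::nat. uniform_count_measure (UNIV :: bool set)" UNIV
    by unfold_locales (auto intro!: prob_space_uniform_count_measure
        prob_space.emeasure_space_1 prob_space_imp_sigma_finite prob_space.axioms
        sigma_finite_measure.sigma_finite_countable finite_measure.finite_emeasure_space)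
  have "emeasure haar {x. \<forall>i\<in>J. x i = s i}
      = (\<Prod>i\<in>J. emeasure (uniform_count_measure (UNIV :: bool set)) {s i})"
    using emeasure_PiM_Collect[of J "\<lambda>i. {s i}"] assms
    by (simp add: haar_def space_PiM space_uniform_count_measure sets_uniform_count_measure)
  also have "\<dots> = ennreal ((1/2) ^ card J)"
    by (simp add: emeasure_uniform_count_measure ennreal_power[symmetric]
        power_inverse[symmetric] divide_ennreal_def inverse_ennreal[symmetric] ennreal_numeral[symmetric]
        del: ennreal_numeral)
  finally show ?thesis .
qed


section \<open>The measure algebra\<close>

lemma null_sets_haar_subset:
  assumes "N \<in> null_sets haar" "A \<in> sets borel" "A \<subseteq> N"
  shows "A \<in> null_sets haar"
  using assms by (auto intro: null_sets_subset simp: sets_haar)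

quotient_type measure_algebra = "(nat \<Rightarrow> bool) set" / partial:
  "\<lambda>A B. A \<in> sets borel \<and> B \<in> sets borel \<and> (A - B) \<union> (B - A) \<in> null_sets haar"
proof (rule part_equivpI)
  show "\<exists>A. A \<in> sets borel \<and> A \<in> sets borel \<and> (A - A) \<union> (A - A) \<in> null_sets haar"
    by (rule exI[of _ "{}"]) simp
next
  show "symp (\<lambda>A B. A \<in> sets borel \<and> B \<in> sets borel \<and> (A - B) \<union> (B - A) \<in> null_sets haar)"
    by (auto intro!: sympI simp: Un_commute)
next
  show "transp (\<lambda>A B. A \<in> sets borel \<and> B \<in> sets borel \<and> (A - B) \<union> (B - A) \<in> null_sets haar)"
  proof (rule transpI, elim conjE, intro conjI)
    fix A B C :: "(nat \<Rightarrow> bool) set"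
    assume S: "A \<in> sets borel" "C \<in> sets borel"
      and N: "(A - B) \<union> (B - A) \<in> null_sets haar" "(B - C) \<union> (C - B) \<in> null_sets haar"
    show "(A - C) \<union> (C - A) \<in> null_sets haar"
      by (rule null_sets_haar_subset[OF null_sets.Un[OF N]]) (use S in auto)
  qed
qed

instantiation measure_algebra :: boolean_algebra
begin

lift_definition bot_measure_algebra :: measure_algebra is "{}" by simp

lift_definition top_measure_algebra :: measure_algebra is "UNIV" by simp

lift_definition inf_measure_algebra :: "measure_algebra \<Rightarrow> measure_algebra \<Rightarrow> measure_algebra"
  is "(\<inter>)"
  by (elim conjE, intro conjI sets.Int, assumption+)
     (erule (1) null_sets_haar_subset[OF null_sets.Un], auto)

lift_definition sup_measure_algebra :: "measure_algebra \<Rightarrow> measure_algebra \<Rightarrow> measure_algebra"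
  is "(\<union>)"
  by (elim conjE, intro conjI sets.Un, assumption+)
     (erule (1) null_sets_haar_subset[OF null_sets.Un], auto)

lift_definition minus_measure_algebra :: "measure_algebra \<Rightarrow> measure_algebra \<Rightarrow> measure_algebra"
  is "(-)"
  by (elim conjE, intro conjI sets.Diff, assumption+)
     (erule (1) null_sets_haar_subset[OF null_sets.Un], auto)

lift_definition uminus_measure_algebra :: "measure_algebra \<Rightarrow> measure_algebra"
  is "uminus"
  by (auto simp: Un_commute Diff_eq Int_commute)

lift_definition less_eq_measure_algebra :: "measure_algebra \<Rightarrow> measure_algebra \<Rightarrow> bool"
  is "\<lambda>A B. A - B \<in> null_sets haar"
proof -
  fix A A' B B' :: "(nat \<Rightarrow> bool) set"
  assume "A \<in> sets borel \<and> A' \<in> sets borel \<and> (A - A') \<union> (A' - A) \<in> null_sets haar"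
    and "B \<in> sets borel \<and> B' \<in> sets borel \<and> (B - B') \<union> (B' - B) \<in> null_sets haar"
  then have S: "A \<in> sets borel" "A' \<in> sets borel" "B \<in> sets borel" "B' \<in> sets borel"
    and N: "((A - A') \<union> (A' - A)) \<union> ((B - B') \<union> (B' - B)) \<in> null_sets haar" by auto
  show "A - B \<in> null_sets haar \<longleftrightarrow> A' - B' \<in> null_sets haar"
  proof
    assume "A - B \<in> null_sets haar"
    from null_sets.Un[OF N this] show "A' - B' \<in> null_sets haar"
      by (rule null_sets_haar_subset) (use S in auto)
  next
    assume "A' - B' \<in> null_sets haar"
    from null_sets.Un[OF N this] show "A - B \<in> null_sets haar"
      by (rule null_sets_haar_subset) (use S in auto)
  qed
qed

definition less_measure_algebra :: "measure_algebra \<Rightarrow> measure_algebra \<Rightarrow> bool" where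
  "less_measure_algebra a b \<longleftrightarrow> a \<le> b \<and> \<not> b \<le> a"

instance
proof
  fix a b c :: measure_algebra
  show "a < b \<longleftrightarrow> a \<le> b \<and> \<not> b \<le> a" by (rule less_measure_algebra_def)
  show "a \<le> a" by transfer simp
  show "a \<le> c" if "a \<le> b" "b \<le> c"
    using that
  proof transfer
    fix A B C :: "(nat \<Rightarrow> bool) set"
    assume *: "A - B \<in> null_sets haar" "B - C \<in> null_sets haar"
      and "A \<in> sets borel \<and> A \<in> sets borel \<and> (A - A) \<union> (A - A) \<in> null_sets haar"
        "C \<in> sets borel \<and> C \<in> sets borel \<and> (C - C) \<union> (C - C) \<in> null_sets haar"
    then show "A - C \<in> null_sets haar"
      by (intro null_sets_haar_subset[OF null_sets.Un[OF *]]) auto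
  qed
  show "a = b" if "a \<le> b" "b \<le> a" using that by transfer auto
  have *: "A \<inter> B - A = {}" "A \<inter> B - B = {}"
    "A - (A \<union> B) = {}" "B - (A \<union> B) = {}" for A B :: "(nat \<Rightarrow> bool) set" by auto
  show "inf a b \<le> a" by transfer (simp add: *)
  show "inf a b \<le> b" by transfer (simp add: *)
  show "a \<le> inf b c" if "a \<le> b" "a \<le> c" using that by transfer (auto simp: Diff_Int)
  show "a \<le> sup a b" by transfer (simp add: *)
  show "b \<le> sup a b" by transfer (simp add: *)
  show "sup b c \<le> a" if "b \<le> a" "c \<le> a" using that by transfer (auto simp: Un_Diff)
  show "bot \<le> a" by transfer simp
  show "a \<le> top" by transfer simp
  show "sup a (inf b c) = inf (sup a b) (sup a c)"
    by transfer (simp add: Un_Int_distrib)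
  show "inf a (- a) = bot" by transfer simp
  show "sup a (- a) = top" by transfer simp
  show "a - b = inf a (- b)" by transfer (simp add: Diff_eq)
qed

end


section \<open>Stone spaces\<close>

definition ultrafilter :: "'a::boolean_algebra set \<Rightarrow> bool" where
  "ultrafilter U \<longleftrightarrow>
     top \<in> U \<and> bot \<notin> U \<and>
     (\<forall>a\<in>U. \<forall>b\<in>U. inf a b \<in> U) \<and>
     (\<forall>a\<in>U. \<forall>b. a \<le> b \<longrightarrow> b \<in> U) \<and>
     (\<forall>a. a \<in> U \<or> - a \<in> U)"

definition stone_space :: "'a::boolean_algebra set topology" where
  "stone_space = topology_generated_by (range (\<lambda>a. {U. ultrafilter U \<and> a \<in> U}))"

lemma topspace_stone_space: "topspace stone_space = {U. ultrafilter U}"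
  by (auto simp: stone_space_def topology_generated_by_topspace ultrafilter_def)


section \<open>Weak P-points\<close>

definition weak_P_point :: "'a topology \<Rightarrow> 'a \<Rightarrow> bool" where
  "weak_P_point X p \<longleftrightarrow>
     p \<in> topspace X \<and>
     (\<forall>C. countable C \<and> C \<subseteq> topspace X - {p} \<longrightarrow> p \<notin> X closure_of C)"

end

theory Submission
  imports Defs
begin

text \<open>
  Split off countably many disjoint pieces of the Cantor space and let \<open>F\<close> be the filter of all
  elements of the measure algebra whose relative measure in the pieces tends to \<open>1\<close>. An ultrafilter
  not extending \<open>F\<close> contains an element of density tending to \<open>0\<close>, and, the measure being
  nonatomic, one of uniformly small density; so countably many such ultrafilters contain a common
  element of density tending to \<open>0\<close>. Hence no point above \<open>F\<close> is in their closure, and it remains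
  to find a weak P-point among the ultrafilters extending \<open>F\<close>.

  For this Kunen's construction of OK points works. Unions of pieces carry a copy of the subsets
  of \<open>\<omega>\<close>, hence an independent linked matrix with continuum many rows. All continuum many
  sequences \<open>U\<close> of elements are handled in a transfinite recursion, each of them using up finitely
  many rows: either some \<open>- U n\<close> is put into the filter, or all \<open>U n\<close> are, together with uncountably
  many elements any \<open>n + 1\<close> of which meet below \<open>U n\<close> modulo \<open>F\<close>. If \<open>U n\<close> avoids the \<open>n\<close>-th of
  countably many ultrafilters, then each of these contains only finitely many of the uncountably
  many elements, so one of the elements avoids them all.
\<close>

unbundle cardinal_syntax

section \<open>An independent linked matrix of sets of natural numbers\<close>

text \<open>Distinct sets differ at some point, and for finitely many pairs these points have a
  common bound.\<close>

lemma eventually_inj_on_truncation: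
  fixes S :: "nat set set"
  assumes "finite S"
  shows "\<exists>k0. \<forall>k\<ge>k0. inj_on (\<lambda>X. X \<inter> {..<k}) S"
proof -
  define w where "w = (\<lambda>(X, Y). SOME i::nat. (i \<in> X) \<noteq> (i \<in> Y))"
  have w: "(w (X, Y) \<in> X) \<noteq> (w (X, Y) \<in> Y)" if "X \<noteq> Y" for X Y
    unfolding w_def prod.case by (rule someI_ex) (use that in blast)
  have "finite (w ` (S \<times> S))" using assms by simp
  then obtain k0 where k0: "\<forall>i\<in>w ` (S \<times> S). i < k0"
    using finite_nat_set_iff_bounded by blast
  have "inj_on (\<lambda>X. X \<inter> {..<k}) S" if "k \<ge> k0" for k
  proof (rule inj_onI, rule ccontr)
    fix X Y assume XY: "X \<in> S" "Y \<in> S" "X \<inter> {..<k} = Y \<inter> {..<k}" "X \<noteq> Y"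
    then have "w (X, Y) < k" using k0 that by (meson SigmaI image_eqI less_le_trans)
    then show False using w[OF XY(4)] XY(3) by blast
  qed
  then show ?thesis by blast
qed

text \<open>
  This is Kunen's matrix: the index \<open>j\<close> codes a pair \<open>(k, f)\<close> with \<open>f\<close> a relation between
  subsets of \<open>{..<k}\<close>, and \<open>j\<close> belongs to \<open>\<alpha> Y X n\<close> when \<open>f\<close> relates \<open>Y \<inter> k\<close> to at most \<open>n\<close>
  sets, one of which is \<open>X \<inter> k\<close>.
\<close>

lemma independent_linked_matrix_exists:
  obtains \<alpha> :: "nat set \<Rightarrow> nat set \<Rightarrow> nat \<Rightarrow> nat set" where
    "\<And>Y X. mono (\<alpha> Y X)"
    "\<And>Y S n. card S = Suc n \<Longrightarrow> finite (\<Inter>X\<in>S. \<alpha> Y X n)"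
    "\<And>T. finite T \<Longrightarrow> infinite (\<Inter>(Y, X)\<in>T. \<alpha> Y X (card (T `` {Y})))"
proof -
  define P where "P = (\<lambda>k::nat. Pow (Pow {..<k} \<times> Pow {..<k}))"
  have finP: "finite (P k)" for k by (simp add: P_def)
  define I where "I = Sigma UNIV P"
  have "I = (\<Union>k. Pair k ` P k)" by (auto simp: I_def)
  then have cI: "countable I" using finP by (simp add: countable_finite)
  have "inj (\<lambda>k. (k, {}) :: nat \<times> (nat set \<times> nat set) set)" by (simp add: inj_def)
  moreover have "range (\<lambda>k. (k, {})) \<subseteq> I" by (auto simp: I_def P_def)
  ultimately have "infinite I" using range_inj_infinite infinite_super by metis
  then have e: "bij_betw (from_nat_into I) UNIV I" by (rule bij_betw_from_nat_into[OF cI])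
  define e where "e = from_nat_into I"
  have inj_e: "inj e" using e by (simp add: bij_betw_def e_def)
  have ran_e: "range e = I" using e by (simp add: bij_betw_def e_def)
  define \<alpha> where "\<alpha> = (\<lambda>Y X n. {j. \<exists>k f. e j = (k, f) \<and> card (f `` {Y \<inter> {..<k}}) \<le> n
    \<and> (Y \<inter> {..<k}, X \<inter> {..<k}) \<in> f})"
  show thesis
  proof
    show "mono (\<alpha> Y X)" for Y X
      by (rule monoI) (auto simp: \<alpha>_def)
  next
    fix Y and S :: "nat set set" and n :: nat assume S: "card S = Suc n"
    then have "finite S" using card_ge_0_finite by force
    then obtain k0 where k0: "\<And>k. k \<ge> k0 \<Longrightarrow> inj_on (\<lambda>X. X \<inter> {..<k}) S"
      using eventually_inj_on_truncation by blast
    \<comment> \<open>If \<open>j\<close> codes \<open>(k, f)\<close> with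
      \<open>k \<ge> k0\<close>, the \<open>n + 1\<close> members of \<open>S\<close> have distinct
      traces on \<open>{..<k}\<close>, too many for \<open>f\<close> to relate to the trace of
      \<open>Y\<close>. Only codes with \<open>k < k0\<close> remain, and there are finitely many of
      them.\<close>
    have "(\<Inter>X\<in>S. \<alpha> Y X n) \<subseteq> e -` (SIGMA k:{..<k0}. P k)"
    proof
      fix j assume j: "j \<in> (\<Inter>X\<in>S. \<alpha> Y X n)"
      obtain k f where kf: "e j = (k, f)" by fastforce
      have fP: "f \<in> P k" using ran_e kf by (metis I_def SigmaD2 rangeI)
      have sub: "(\<lambda>X. X \<inter> {..<k}) ` S \<subseteq> f `` {Y \<inter> {..<k}}"
        using j kf by (auto simp: \<alpha>_def)
      have "S \<noteq> {}" using S by auto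
      then have le: "card (f `` {Y \<inter> {..<k}}) \<le> n" using j kf by (auto simp: \<alpha>_def)
      have "finite f" using fP finite_subset by (fastforce simp: P_def)
      then have "finite (f `` {Y \<inter> {..<k}})" by (rule finite_Image)
      then have "card ((\<lambda>X. X \<inter> {..<k}) ` S) \<le> n"
        using card_mono[OF _ sub] le by linarith
      then have "\<not> inj_on (\<lambda>X. X \<inter> {..<k}) S" using S by (metis card_image not_less_eq_eq order_refl)
      then have "k < k0" using k0 not_le by blast
      then show "j \<in> e -` (SIGMA k:{..<k0}. P k)" using kf fP by auto
    qed
    moreover have "finite (e -` (SIGMA k:{..<k0}. P k))"
      using inj_e finP by (intro finite_vimageI finite_SigmaI) auto
    ultimately show "finite (\<Inter>X\<in>S. \<alpha> Y X n)" by (rule finite_subset)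
  next
    fix T :: "(nat set \<times> nat set) set" assume T: "finite T"
    then obtain k0 where k0: "\<And>k. k \<ge> k0 \<Longrightarrow> inj_on (\<lambda>X. X \<inter> {..<k}) (Domain T)"
      using eventually_inj_on_truncation[OF finite_Domain] by blast
    \<comment> \<open>\<open>f k\<close> is the trace of \<open>T\<close> on \<open>{..<k}\<close>.
      For \<open>k \<ge> k0\<close> truncation keeps the rows of \<open>T\<close> apart, so
      \<open>f k\<close> relates the trace of \<open>Y\<close> to no more sets than \<open>T\<close>
      has columns in row \<open>Y\<close>. Different \<open>k\<close> give different codes.\<close>
    define f where "f = (\<lambda>k::nat. (\<lambda>(Y, X). (Y \<inter> {..<k}, X \<inter> {..<k})) ` T)"
    have "(k, f k) \<in> range e" for k by (auto simp: ran_e I_def P_def f_def)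
    then have "\<exists>j. e j = (k, f k)" for k by (metis rangeE)
    then obtain j where j: "\<And>k. e (j k) = (k, f k)" by metis
    then have "inj j" by (metis injI prod.inject)
    have mem: "j k \<in> \<alpha> Y X (card (T `` {Y}))" if "k \<ge> k0" and YX: "(Y, X) \<in> T" for k Y X
    proof -
      have "f k `` {Y \<inter> {..<k}} \<subseteq> (\<lambda>X. X \<inter> {..<k}) ` (T `` {Y})"
      proof
        fix x assume "x \<in> f k `` {Y \<inter> {..<k}}"
        then obtain Y' X' where *: "(Y', X') \<in> T" "Y' \<inter> {..<k} = Y \<inter> {..<k}" "x = X' \<inter> {..<k}"
          by (auto simp: f_def)
        then have "Y' = Y" using inj_onD[OF k0[OF that(1)]] YX by blast
        then show "x \<in> (\<lambda>X. X \<inter> {..<k}) ` (T `` {Y})" using * by blast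
      qed
      then have "card (f k `` {Y \<inter> {..<k}}) \<le> card (T `` {Y})"
        by (rule surj_card_le[OF finite_Image[OF T]])
      moreover have "(Y \<inter> {..<k}, X \<inter> {..<k}) \<in> f k" using YX by (force simp: f_def)
      ultimately show ?thesis using j by (auto simp: \<alpha>_def)
    qed
    have "j ` {k0..} \<subseteq> (\<Inter>(Y, X)\<in>T. \<alpha> Y X (card (T `` {Y})))" using mem by auto
    moreover have "infinite (j ` {k0..})"
      using \<open>inj j\<close> infinite_Ici by (metis finite_imageD inj_on_subset subset_UNIV)
    ultimately show "infinite (\<Inter>(Y, X)\<in>T. \<alpha> Y X (card (T `` {Y})))"
      using infinite_super by blast
  qed
qed

section \<open>Building an ultrafilter from an independent linked matrix\<close>

definition lattice_filter :: "'a::bounded_semilattice_inf_top set \<Rightarrow> bool" where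
  "lattice_filter G \<longleftrightarrow> top \<in> G \<and> (\<forall>a\<in>G. \<forall>b\<in>G. inf a b \<in> G) \<and> (\<forall>a\<in>G. \<forall>b\<ge>a. b \<in> G)"

lemma lattice_filter_directed_Union:
  assumes "\<And>i. i \<in> I \<Longrightarrow> lattice_filter (H i)" and "I \<noteq> {}"
    and "\<And>i j. i \<in> I \<Longrightarrow> j \<in> I \<Longrightarrow> H i \<subseteq> H j \<or> H j \<subseteq> H i"
  shows "lattice_filter (\<Union>i\<in>I. H i)"
  unfolding lattice_filter_def
proof (intro conjI ballI allI impI)
  show "top \<in> (\<Union>i\<in>I. H i)" using assms by (auto simp: lattice_filter_def)
  show "inf a b \<in> (\<Union>i\<in>I. H i)" if ab: "a \<in> (\<Union>i\<in>I. H i)" "b \<in> (\<Union>i\<in>I. H i)" for a b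
  proof -
    obtain i j where ij: "i \<in> I" "j \<in> I" "a \<in> H i" "b \<in> H j"
      using ab by blast
    then obtain l where "l \<in> I" "a \<in> H l" "b \<in> H l" using assms(3)[OF ij(1,2)] by blast
    then show ?thesis using assms(1) by (auto simp: lattice_filter_def)
  qed
  show "b \<in> (\<Union>i\<in>I. H i)" if "a \<in> (\<Union>i\<in>I. H i)" "a \<le> b" for a b
    using that assms(1) unfolding lattice_filter_def by blast
qed

text \<open>This keeps a row available throughout the recursion: the union of the rows used so far
  is finite, or no larger than \<open>B\<close>, which is smaller than the set of all rows.\<close>

lemma Union_finite_ne_UNIV:
  fixes c :: "'t \<Rightarrow> 'i" and R :: "'t \<Rightarrow> 'i set"
  assumes "inj c" "infinite (UNIV :: 'i set)" "\<And>t. t \<in> B \<Longrightarrow> finite (R t)"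
    and B: "|B| <o |UNIV :: 't set|"
  shows "(\<Union>t\<in>B. R t) \<noteq> UNIV"
proof (cases "finite B")
  case True
  then show ?thesis using assms by (metis finite_UN_I)
next
  case False
  have "|R t| \<le>o |B|" if "t \<in> B" for t
  proof -
    have "|R t| <o natLeq" using assms(3)[OF that] by (simp add: finite_iff_ordLess_natLeq)
    moreover have "natLeq \<le>o |B|" using False infinite_iff_natLeq_ordLeq by blast
    ultimately show ?thesis by (rule ordLess_imp_ordLeq[OF ordLess_ordLeq_trans])
  qed
  then have "|\<Union>t\<in>B. R t| \<le>o |B|"
    using False by (intro card_of_UNION_ordLeq_infinite) (auto intro: card_of_mono1)
  moreover have "|UNIV :: 't set| \<le>o |UNIV :: 'i set|"
    using assms(1) card_of_ordLeq by blast
  ultimately have "|\<Union>t\<in>B. R t| <o |UNIV :: 'i set|"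
    using B ordLeq_ordLess_trans ordLess_ordLeq_trans by blast
  then show ?thesis using ordLess_irreflexive by fastforce
qed

text \<open>
  \<open>E T\<close> stands for the meet of the entries \<open>A Y X (card (T `` {Y}))\<close> with \<open>(Y, X) \<in> T\<close>: row \<open>Y\<close>
  is used at the level on which exactly \<open>card (T `` {Y})\<close> of its columns still have to meet.
\<close>

locale linked_matrix =
  fixes F :: "'a::boolean_algebra set"
    and A :: "'i \<Rightarrow> nat set \<Rightarrow> nat \<Rightarrow> 'a"
    and E :: "('i \<times> nat set) set \<Rightarrow> 'a"
  assumes filter_F: "lattice_filter F"
    and mono_A: "mono (A Y X)"
    and linked: "card (S :: nat set set) = Suc k \<Longrightarrow> \<exists>h\<in>F. \<forall>z\<le>h. (\<forall>X\<in>S. z \<le> A Y X k) \<longrightarrow> z = bot"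
    and E_le: "X \<in> S \<Longrightarrow> E ({Y} \<times> S) \<le> A Y X (card S)"
    and E_Un: "Domain T \<inter> Domain T' = {} \<Longrightarrow> E (T \<union> T') = inf (E T) (E T')"
    and E_pos: "f \<in> F \<Longrightarrow> finite T \<Longrightarrow> inf f (E T) \<noteq> bot"
    and countable_inf: "\<exists>g. (\<forall>n::nat. g \<le> (b n :: 'a)) \<and> (\<forall>u. (\<forall>n. u \<le> b n) \<longrightarrow> u \<le> g)"
begin

text \<open>\<Gamma> collects the rows that are still free. The choice \<open>T = {}\<close> makes
  \<open>G\<close> proper, which \<open>lattice_filter\<close> leaves open.\<close>

definition indep :: "'a set \<Rightarrow> 'i set \<Rightarrow> bool" where
  "indep G \<Gamma> \<longleftrightarrow> (\<forall>g\<in>G. \<forall>T. finite T \<longrightarrow> Domain T \<subseteq> \<Gamma> \<longrightarrow> inf g (E T) \<noteq> bot)"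

text \<open>The instance of Kunen's notion of an OK point for the sequence \<open>U\<close>, modulo \<open>F\<close>.\<close>

definition ok_family :: "(nat \<Rightarrow> 'a) \<Rightarrow> (nat set \<Rightarrow> 'a) \<Rightarrow> bool" where
  "ok_family U V \<longleftrightarrow> (\<forall>k S. card S = Suc k \<longrightarrow>
     (\<exists>h\<in>F. \<forall>z\<le>h. (\<forall>X\<in>S. z \<le> V X) \<longrightarrow> z \<le> U k))"

text \<open>For a constant sequence this puts \<open>U 0\<close> or its complement into
  \<open>G\<close>, so deciding all sequences makes a proper filter an ultrafilter.\<close>

definition decided :: "(nat \<Rightarrow> 'a) \<Rightarrow> 'a set \<Rightarrow> bool" where
  "decided U G \<longleftrightarrow> (antimono U \<longrightarrow>
     (\<exists>n. - U n \<in> G) \<or> range U \<subseteq> G \<and> (\<exists>V. range V \<subseteq> G \<and> ok_family U V))"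

section \<open>Deciding one sequence at the cost of finitely many rows\<close>

lemma decided_mono: "decided U G \<Longrightarrow> G \<subseteq> G' \<Longrightarrow> decided U G'"
  unfolding decided_def by blast

text \<open>Adjoining \<open>E T\<close> to \<open>G\<close> forces \<open>- U n\<close> in and uses
  up the rows of \<open>T\<close>. For a finite \<open>T'\<close> over the other rows,
  \<open>E T\<close> and \<open>E T'\<close> meet in \<open>E (T \<union> T')\<close>, so
  independence survives.\<close>

lemma decide_negatively:
  assumes G: "lattice_filter G" "indep G \<Gamma>"
    and T: "finite T" "Domain T \<subseteq> \<Gamma>" and g: "g \<in> G" "inf (inf g (U n)) (E T) = bot"
  shows "\<exists>G' R. lattice_filter G' \<and> G \<subseteq> G' \<and> finite R \<and> indep G' (\<Gamma> - R) \<and> decided U G'"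
proof (intro exI conjI)
  define G' where "G' = {b. \<exists>g\<in>G. inf g (E T) \<le> b}"
  show "lattice_filter G'"
    unfolding lattice_filter_def
  proof (intro conjI ballI allI impI)
    show "top \<in> G'" using g by (auto simp: G'_def)
    show "inf a b \<in> G'" if ab: "a \<in> G'" "b \<in> G'" for a b
    proof -
      obtain g1 g2 where *: "g1 \<in> G" "g2 \<in> G" "inf g1 (E T) \<le> a" "inf g2 (E T) \<le> b"
        using ab by (auto simp: G'_def)
      then have "inf g1 g2 \<in> G" using G by (simp add: lattice_filter_def)
      moreover have "inf (inf g1 g2) (E T) \<le> inf a b"
        using order_trans[OF inf_mono[OF inf_le1 order_refl] *(3)]
        order_trans[OF inf_mono[OF inf_le2 order_refl] *(4)] by (rule inf_greatest)
      ultimately show ?thesis by (auto simp: G'_def)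
    qed
    show "b \<in> G'" if "a \<in> G'" "a \<le> b" for a b
      using that order_trans by (fastforce simp: G'_def)
  qed
  show "G \<subseteq> G'" by (auto simp: G'_def intro: le_infI1)
  show "finite (Domain T)" using T by (simp add: finite_Domain)
  show "indep G' (\<Gamma> - Domain T)"
    unfolding indep_def
  proof (intro ballI allI impI)
    fix b and T' :: "('i \<times> nat set) set" assume b: "b \<in> G'" and T': "finite T'" "Domain T' \<subseteq> \<Gamma> - Domain T"
    obtain g' where g': "g' \<in> G" "inf g' (E T) \<le> b" using b by (auto simp: G'_def)
    have "inf g' (E (T \<union> T')) \<noteq> bot"
      using G(2)[unfolded indep_def, rule_format, OF g'(1), of "T \<union> T'"] T T' by auto
    moreover have "E (T \<union> T') = inf (E T) (E T')" using T' by (intro E_Un) auto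
    moreover have "inf (inf g' (E T)) (E T') \<le> inf b (E T')"
      using g'(2) by (rule inf_mono) simp
    ultimately show "inf b (E T') \<noteq> bot" by (metis inf.assoc le_bot)
  qed
  have "inf g (E T) \<le> - U n"
    using g(2) by (subst inf_shunt[symmetric]) (simp add: ac_simps)
  then have "- U n \<in> G'" using g by (auto simp: G'_def)
  then show "decided U G'" by (auto simp: decided_def)
qed

text \<open>
  The new elements are the meets \<open>V X\<close> of all \<open>sup (U k) (A Y X k)\<close>: outside \<open>U k\<close>, any \<open>k + 1\<close> of
  them meet below \<open>k + 1\<close> entries of level \<open>k\<close>, that is, trivially; and since \<open>A\<close> increases and \<open>U\<close>
  decreases, \<open>n\<close> of them still contain the meet of \<open>U n\<close> with \<open>n\<close> entries of level \<open>n\<close>.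
\<close>

lemma decide_positively:
  assumes G: "lattice_filter G" "F \<subseteq> G" and Y: "Y \<in> \<Gamma>" and U: "antimono U"
    and pos: "\<And>g n T. g \<in> G \<Longrightarrow> finite T \<Longrightarrow> Domain T \<subseteq> \<Gamma> \<Longrightarrow> inf (inf g (U n)) (E T) \<noteq> bot"
  shows "\<exists>G' R. lattice_filter G' \<and> G \<subseteq> G' \<and> finite R \<and> indep G' (\<Gamma> - R) \<and> decided U G'"
proof -
  have "\<exists>v. (\<forall>k. v \<le> sup (U k) (A Y X k)) \<and> (\<forall>u. (\<forall>k. u \<le> sup (U k) (A Y X k)) \<longrightarrow> u \<le> v)" for X
    by (rule countable_inf)
  then obtain V where V: "\<And>X. (\<forall>k. V X \<le> sup (U k) (A Y X k)) \<and>
      (\<forall>u. (\<forall>k. u \<le> sup (U k) (A Y X k)) \<longrightarrow> u \<le> V X)"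
    by metis
  have V_le: "V X \<le> sup (U k) (A Y X k)" for X k using V by simp
  have le_V: "u \<le> V X" if "\<And>k. u \<le> sup (U k) (A Y X k)" for X u using V that by simp
  \<comment> \<open>\<open>L g n S\<close> is the set of lower bounds of \<open>g\<close>,
    \<open>U n\<close> and the \<open>V X\<close> with \<open>X \<in> S\<close>, in place of a
    finite meet. Thus \<open>G'\<close> is the filter generated by \<open>G\<close>, all
    \<open>U n\<close> and all \<open>V X\<close>.\<close>
  define L where "L = (\<lambda>g n S. {z. z \<le> g \<and> z \<le> U n \<and> (\<forall>X\<in>S. z \<le> V X)})"
  define G' where "G' = {b. \<exists>g\<in>G. \<exists>n S. finite S \<and> (\<forall>z\<in>L g n S. z \<le> b)}"
  have G'I: "b \<in> G'" if "g \<in> G" "finite S" "\<And>z. z \<in> L g n S \<Longrightarrow> z \<le> b" for b g n S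
    using that unfolding G'_def by blast
  have G'E: thesis if "b \<in> G'"
    "\<And>g n S. g \<in> G \<Longrightarrow> finite S \<Longrightarrow> (\<And>z. z \<in> L g n S \<Longrightarrow> z \<le> b) \<Longrightarrow> thesis" for b thesis
    using that unfolding G'_def by blast
  have top_G: "top \<in> G" using G by (simp add: lattice_filter_def)
  have filter: "lattice_filter G'"
    unfolding lattice_filter_def
  proof (intro conjI ballI allI impI)
    show "top \<in> G'" by (rule G'I[OF top_G, of "{}"]) auto
    show "inf a b \<in> G'" if ab: "a \<in> G'" "b \<in> G'" for a b
    proof -
      obtain g m S where 1: "g \<in> G" "finite S"
        "\<And>z. z \<in> L g m S \<Longrightarrow> z \<le> a"
        using G'E[OF ab(1)] by metis
      obtain g' m' S' where 2: "g' \<in> G" "finite S'"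
        "\<And>z. z \<in> L g' m' S' \<Longrightarrow> z \<le> b"
        using G'E[OF ab(2)] by metis
      have "inf g g' \<in> G" using G 1 2 by (simp add: lattice_filter_def)
      moreover have "U (max m m') \<le> U m" "U (max m m') \<le> U m'"
        using U by (simp_all add: antimonoD)
      then have "L (inf g g') (max m m') (S \<union> S') \<subseteq> L g m S \<inter> L g' m' S'"
        unfolding L_def using order_trans by auto
      ultimately show ?thesis
        using 1 2 by (intro G'I[of "inf g g'" "S \<union> S'" "max m m'"]) auto
    qed
    show "b \<in> G'" if a: "a \<in> G'" "a \<le> b" for a b
    proof -
      obtain g m S where "g \<in> G" "finite S"
        "\<And>z. z \<in> L g m S \<Longrightarrow> z \<le> a"
        using G'E[OF a(1)] by metis
      then show ?thesis using a(2) order_trans by (intro G'I[of g S m]) blast+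
    qed
  qed
  have sub: "G \<subseteq> G'"
  proof
    show "g \<in> G'" if "g \<in> G" for g by (rule G'I[OF that, of "{}"]) (auto simp: L_def)
  qed
  have indep: "indep G' (\<Gamma> - {Y})"
    unfolding indep_def
  proof (intro ballI allI impI)
    fix b and T :: "('i \<times> nat set) set" assume b: "b \<in> G'" and T: "finite T" "Domain T \<subseteq> \<Gamma> - {Y}"
    obtain g n S where g: "g \<in> G" and S: "finite S"
      and *: "\<And>z. z \<in> L g n S \<Longrightarrow> z \<le> b"
      using G'E[OF b] by metis
    \<comment> \<open>For \<open>k \<le> m\<close> the bound \<open>U m \<le> U k\<close> puts
      \<open>z\<close> below \<open>sup (U k) (A Y X k)\<close>; for
      \<open>k > m \<ge> card S\<close> the entry of level \<open>card S\<close> does.\<close>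
    define m where "m = max n (card S)"
    define z where "z = inf (inf g (U m)) (E ({Y} \<times> S))"
    have zU: "z \<le> U m" by (simp add: z_def le_infI1)
    have "z \<le> b"
    proof (rule *, unfold L_def, intro CollectI conjI ballI)
      show "z \<le> g" by (simp add: z_def le_infI1)
      show "z \<le> U n" using zU antimonoD[OF U, of n m] by (simp add: m_def)
      fix X assume X: "X \<in> S"
      show "z \<le> V X"
      proof (rule le_V)
        fix k
        show "z \<le> sup (U k) (A Y X k)"
        proof (cases "k \<le> m")
          case True
          then show ?thesis using zU antimonoD[OF U True] by (meson le_supI1 order_trans)
        next
          case False
          then have "card S \<le> k" by (simp add: m_def)
          then have "E ({Y} \<times> S) \<le> A Y X k"
            using E_le[OF X] monoD[OF mono_A] order_trans by blast
          then show ?thesis by (simp add: z_def le_infI2 le_supI2)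
        qed
      qed
    qed
    have "E ({Y} \<times> S \<union> T) = inf (E ({Y} \<times> S)) (E T)"
      using T by (intro E_Un) auto
    moreover have "inf (inf g (U m)) (E ({Y} \<times> S \<union> T)) \<noteq> bot"
      using T S Y by (intro pos g) auto
    moreover have "inf z (E T) \<le> inf b (E T)"
      using \<open>z \<le> b\<close> by (rule inf_mono) simp
    ultimately show "inf b (E T) \<noteq> bot" unfolding z_def by (metis inf.assoc le_bot)
  qed
  have "U n \<in> G'" for n by (rule G'I[OF top_G, of "{}"]) (auto simp: L_def)
  moreover have "V X \<in> G'" for X by (rule G'I[OF top_G, of "{X}"]) (auto simp: L_def)
  moreover have "ok_family U V"
    unfolding ok_family_def
  proof (intro allI impI)
    fix k and S :: "nat set set" assume "card S = Suc k"
    then obtain h where h: "h \<in> F" "\<And>z. z \<le> h \<Longrightarrow> (\<forall>X\<in>S. z \<le> A Y X k) \<Longrightarrow> z = bot"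
      using linked by metis
    have "z \<le> U k" if z: "z \<le> h" "\<forall>X\<in>S. z \<le> V X" for z
    proof -
      have "inf z (- U k) \<le> A Y X k" if "X \<in> S" for X
        using z(2) that V_le[of X k] order_trans by (fastforce simp: shunt1)
      then have "inf z (- U k) = bot" using h(2) z(1) by (simp add: le_infI1)
      then show ?thesis by (simp add: inf_shunt)
    qed
    then show "\<exists>h\<in>F. \<forall>z\<le>h. (\<forall>X\<in>S. z \<le> V X) \<longrightarrow> z \<le> U k" using h(1) by blast
  qed
  ultimately have "decided U G'" unfolding decided_def by blast
  then show ?thesis using filter sub indep by (intro exI[of _ G'] exI[of _ "{Y}"]) simp
qed

text \<open>If some \<open>U n\<close> is incompatible with a member of \<open>G\<close> over
  finitely many free rows, its complement can be added; otherwise all \<open>U n\<close> and a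
  linked family can be added, which uses a single row.\<close>

lemma decide:
  assumes "lattice_filter G" "F \<subseteq> G" "indep G \<Gamma>" "\<Gamma> \<noteq> {}"
  shows "\<exists>G' R. lattice_filter G' \<and> G \<subseteq> G' \<and> finite R \<and> indep G' (\<Gamma> - R) \<and> decided U G'"
proof (cases "antimono U")
  case False
  then have "decided U G" by (simp add: decided_def)
  then show ?thesis using assms by (intro exI[of _ G] exI[of _ "{}"]) simp
next
  case True
  obtain Y where "Y \<in> \<Gamma>" using assms(4) by blast
  then show ?thesis
    using decide_negatively[OF assms(1,3)] decide_positively[OF assms(1,2) _ True] by metis
qed

section \<open>Transfinite recursion over all sequences\<close>

lemma deciding_ultrafilter:
  fixes c :: "(nat \<Rightarrow> 'a) \<Rightarrow> 'i"
  assumes "inj c" "infinite (UNIV :: 'i set)"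
  obtains p where "ultrafilter p" "F \<subseteq> p" "\<And>U. decided U p"
proof -
  \<comment> \<open>\<open>r\<close> well-orders the sequences in the type of a cardinal, so every
    stage has fewer predecessors than there are sequences.\<close>
  define r where "r = |UNIV :: (nat \<Rightarrow> 'a) set|"
  have wo: "Well_order r" and co: "Card_order r" and Fr: "Field r = UNIV"
    unfolding r_def by (rule card_of_Well_order card_of_Card_order Field_card_of)+
  have wf: "wf (r - Id)" using wo by (simp add: well_order_on_def)
  have trans_r: "(x, z) \<in> r - Id" if "(x, y) \<in> r - Id" "(y, z) \<in> r - Id" for x y z
    using that wo unfolding order_on_defs well_order_on_def
    by (metis DiffD1 DiffD2 DiffI IdI antisymD pair_in_Id_conv transD)
  have total_r: "x = y \<or> (x, y) \<in> r - Id \<or> (y, x) \<in> r - Id" for x y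
    using wo Fr unfolding order_on_defs well_order_on_def total_on_def by auto
  \<comment> \<open>\<open>f y\<close> pairs the filter after stage \<open>y\<close> with the rows
    used at that stage; \<open>G f x\<close> and \<open>\<Gamma> f x\<close> are the filter and the
    free rows on entering stage \<open>x\<close>.\<close>
  define G where "G = (\<lambda>(f :: _ \<Rightarrow> 'a set \<times> 'i set) x. F \<union> (\<Union>y\<in>underS r x. fst (f y)))"
  define \<Gamma> where "\<Gamma> = (\<lambda>(f :: _ \<Rightarrow> 'a set \<times> 'i set) x. - (\<Union>y\<in>underS r x. snd (f y)))"
  define P where "P = (\<lambda>f x (H, R). lattice_filter H \<and> G f x \<subseteq> H \<and> finite R \<and>
    indep H (\<Gamma> f x - R) \<and> decided x H)"
  have underS: "y \<in> underS r x \<longleftrightarrow> (y, x) \<in> r - Id" for x y by (auto simp: underS_def)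
  have filter_Union: "lattice_filter (F \<union> (\<Union>y\<in>D. fst (f y)))"
    if "\<And>y. y \<in> D \<Longrightarrow> P f y (f y)" for f :: "(nat \<Rightarrow> 'a) \<Rightarrow> 'a set \<times> 'i set" and D
  proof (cases "D = {}")
    case True
    then show ?thesis using filter_F by simp
  next
    case False
    have *: "lattice_filter (fst (f y))" "F \<subseteq> fst (f y)" "G f y \<subseteq> fst (f y)" if "y \<in> D" for y
      using \<open>\<And>y. y \<in> D \<Longrightarrow> P f y (f y)\<close>[OF that] by (auto simp: P_def G_def split: prod.splits)
    have mono: "fst (f x) \<subseteq> fst (f y)" if "x \<in> D" "y \<in> D" "(x, y) \<in> r - Id" for x y
      using *(3)[OF that(2)] that(3) unfolding G_def underS[symmetric] by blast
    have "lattice_filter (\<Union>y\<in>D. fst (f y))"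
    proof (rule lattice_filter_directed_Union[OF *(1) False])
      show "fst (f x) \<subseteq> fst (f y) \<or> fst (f y) \<subseteq> fst (f x)" if "x \<in> D" "y \<in> D" for x y
        using total_r[of x y] mono[OF that] mono[OF that(2,1)] by auto
    qed
    moreover have "F \<subseteq> (\<Union>y\<in>D. fst (f y))" using * False by blast
    ultimately show ?thesis by (simp add: Un_absorb1)
  qed
  have "\<exists>f. \<forall>x. P f x (f x)"
  proof (rule dependent_wf_choice[OF wf])
    fix f g :: "(nat \<Rightarrow> 'a) \<Rightarrow> 'a set \<times> 'i set" and x z
    assume "\<And>z. (z, x) \<in> r - Id \<Longrightarrow> f z = g z"
    then have "G f x = G g x" "\<Gamma> f x = \<Gamma> g x" by (simp_all add: G_def \<Gamma>_def underS)
    then show "P f x z = P g x z" by (simp add: P_def)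
  next
    fix f :: "(nat \<Rightarrow> 'a) \<Rightarrow> 'a set \<times> 'i set" and x
    assume "\<And>y. (y, x) \<in> r - Id \<Longrightarrow> P f y (f y)"
    then have P: "P f y (f y)" if "y \<in> underS r x" for y using that underS by blast
    have "lattice_filter (G f x)" unfolding G_def by (rule filter_Union) (rule P)
    moreover have "F \<subseteq> G f x" by (simp add: G_def)
    moreover have "indep (G f x) (\<Gamma> f x)"
      unfolding indep_def
    proof (intro ballI allI impI)
      fix g and T :: "('i \<times> nat set) set" assume g: "g \<in> G f x" and T: "finite T" "Domain T \<subseteq> \<Gamma> f x"
      show "inf g (E T) \<noteq> bot"
      proof (cases "g \<in> F")
        case True
        then show ?thesis using E_pos T by blast
      next
        case False
        \<comment> \<open>\<open>g\<close> was already present after an earlier stage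
          \<open>y\<close>, and the rows free at \<open>x\<close> are among those free after
          \<open>y\<close>.\<close>
        then obtain y where y: "y \<in> underS r x" "g \<in> fst (f y)" using g by (auto simp: G_def)
        have "z \<in> underS r x" if "z \<in> underS r y" for z
          using that y(1) unfolding underS by (rule trans_r)
        then have "\<Gamma> f x \<subseteq> \<Gamma> f y - snd (f y)" using y(1) unfolding \<Gamma>_def by blast
        moreover have "indep (fst (f y)) (\<Gamma> f y - snd (f y))"
          using P[OF y(1)] by (auto simp: P_def split: prod.splits)
        ultimately show ?thesis using y T unfolding indep_def by blast
      qed
    qed
    moreover have "\<Gamma> f x \<noteq> {}"
    proof -
      have "|underS r x| <o |UNIV :: (nat \<Rightarrow> 'a) set|"
        using card_of_underS[OF co] Fr by (simp add: r_def)
      moreover have "finite (snd (f y))" if "y \<in> underS r x" for y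
        using P[OF that] by (auto simp: P_def split: prod.splits)
      ultimately have "(\<Union>y\<in>underS r x. snd (f y)) \<noteq> UNIV"
        by (intro Union_finite_ne_UNIV[OF assms])
      then show ?thesis unfolding \<Gamma>_def by (metis double_compl Compl_empty_eq)
    qed
    ultimately have "\<exists>H R. lattice_filter H \<and> G f x \<subseteq> H \<and> finite R \<and> indep H (\<Gamma> f x - R) \<and> decided x H"
      by (rule decide)
    then obtain H R where "P f x (H, R)" unfolding P_def by auto
    then show "\<exists>z. P f x z" by blast
  qed
  then obtain f where f: "\<And>x. P f x (f x)" by blast
  then have f': "decided x (fst (f x))" "indep (fst (f x)) (\<Gamma> f x - snd (f x))" for x
    by (simp_all add: P_def split_beta)
  define p where "p = F \<union> (\<Union>y. fst (f y))"
  have p: "lattice_filter p" unfolding p_def by (rule filter_Union) (rule f)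
  have dec: "decided U p" for U
    by (rule decided_mono[OF f'(1)]) (auto simp: p_def)
  have "bot \<notin> fst (f y)" for y
    using f'(2)[of y] unfolding indep_def by (metis Domain_empty empty_subsetI finite.emptyI inf_bot_left)
  moreover have "bot \<notin> F" using E_pos[of bot "{}"] by auto
  ultimately have "bot \<notin> p" by (auto simp: p_def)
  moreover have "a \<in> p \<or> - a \<in> p" for a
    using dec[of "\<lambda>_. a"] by (auto simp: decided_def)
  ultimately have "ultrafilter p" using p unfolding ultrafilter_def lattice_filter_def by blast
  moreover have "F \<subseteq> p" by (simp add: p_def)
  ultimately show thesis using dec by (rule that)
qed

end

section \<open>From deciding ultrafilters to weak P-points\<close>

lemma ultrafilter_uminus: "ultrafilter q \<Longrightarrow> a \<notin> q \<longleftrightarrow> - a \<in> q"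
  unfolding ultrafilter_def by (metis inf_compl_bot)

lemma ultrafilter_upward: "ultrafilter q \<Longrightarrow> a \<in> q \<Longrightarrow> a \<le> b \<Longrightarrow> b \<in> q"
  unfolding ultrafilter_def by blast

lemma ultrafilter_eqI:
  assumes "ultrafilter p" "ultrafilter q" "p \<subseteq> q"
  shows "p = q"
  using assms ultrafilter_uminus by blast

lemma ultrafilter_lower_bound:
  assumes "ultrafilter q" "finite S" "\<And>X. X \<in> S \<Longrightarrow> V X \<in> q" "h \<in> q"
  shows "\<exists>z\<in>q. z \<le> h \<and> (\<forall>X\<in>S. z \<le> V X)"
  using assms(2,3)
proof (induction S)
  case empty
  then show ?case using assms(4) by auto
next
  case (insert X S)
  then obtain z where "z \<in> q" "z \<le> h" "\<forall>Y\<in>S. z \<le> V Y" by auto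
  moreover have "inf z (V X) \<in> q" using \<open>z \<in> q\<close> insert assms(1) by (auto simp: ultrafilter_def)
  ultimately show ?case by (intro bexI[of _ "inf z (V X)"]) (auto intro: le_infI1)
qed

context linked_matrix
begin

lemma deciding_ultrafilter_separates:
  assumes p: "ultrafilter p" "F \<subseteq> p" "\<And>U. decided U p"
    and C: "countable C" "\<And>q. q \<in> C \<Longrightarrow> ultrafilter q \<and> F \<subseteq> q \<and> q \<noteq> p"
  shows "\<exists>v\<in>p. \<forall>q\<in>C. v \<notin> q"
proof (cases "C = {}")
  case True
  then show ?thesis using p(1) by (auto simp: ultrafilter_def)
next
  case False
  define q where "q = from_nat_into C"
  have qC: "q i \<in> C" for i using False by (simp add: q_def from_nat_into)
  then have q: "ultrafilter (q i)" "F \<subseteq> q i" "q i \<noteq> p" for i using C by blast+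
  have "\<exists>b. b \<in> p \<and> b \<notin> q i" for i using ultrafilter_eqI[OF p(1) q(1)] q(3) by blast
  then obtain b where b: "\<And>i. b i \<in> p" "\<And>i. b i \<notin> q i" by metis
  \<comment> \<open>\<open>U n\<close> is the meet of \<open>b 0\<close>, ..., \<open>b n\<close>:
    decreasing, in \<open>p\<close>, and below \<open>b n\<close>, hence outside \<open>q n\<close>.
    As no \<open>- U n\<close> lies in \<open>p\<close>, deciding \<open>U\<close> yields the family
    \<open>V\<close>.\<close>
  define U where "U = rec_nat (b 0) (\<lambda>n u. inf u (b (Suc n)))"
  have U0: "U 0 = b 0" and US: "U (Suc n) = inf (U n) (b (Suc n))" for n by (simp_all add: U_def)
  have "antimono U" by (rule decseq_SucI) (simp add: US)
  have Up: "U n \<in> p" for n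
    using p(1) b(1) by (induction n) (auto simp: U0 US ultrafilter_def)
  then have "- U n \<notin> p" for n using ultrafilter_uminus[OF p(1)] by blast
  then obtain V where V: "range V \<subseteq> p" "ok_family U V"
    using p(3)[of U] \<open>antimono U\<close> unfolding decided_def by blast
  have Uq: "U i \<notin> q i" for i
  proof
    assume "U i \<in> q i"
    moreover have "U i \<le> b i" by (cases i) (simp_all add: U0 US)
    ultimately show False using q(1)[of i] b(2)[of i] unfolding ultrafilter_def by blast
  qed
  \<comment> \<open>If \<open>q i\<close> contained \<open>i + 1\<close> of the \<open>V X\<close>,
    it would contain an element below all of these and below the \<open>h \<in> F\<close> given by
    \<open>ok_family\<close>; such an element lies below \<open>U i\<close>.\<close>
  have "finite {X. V X \<in> q i}" for i
  proof (rule ccontr)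
    assume "infinite {X. V X \<in> q i}"
    then obtain S where S: "finite S" "card S = Suc i" "S \<subseteq> {X. V X \<in> q i}"
      using infinite_arbitrarily_large by blast
    obtain h where h: "h \<in> F" "\<And>z. z \<le> h \<Longrightarrow> (\<forall>X\<in>S. z \<le> V X) \<Longrightarrow> z \<le> U i"
      using V(2) S(2) unfolding ok_family_def by blast
    obtain z where "z \<in> q i" "z \<le> h" "\<forall>X\<in>S. z \<le> V X"
      using ultrafilter_lower_bound[OF q(1)[of i] S(1), of V h] S(3) h(1) q(2) by blast
    then have "U i \<in> q i" using h(2) q(1)[of i] by (auto simp: ultrafilter_def)
    then show False using Uq by blast
  qed
  then have "countable (\<Union>i. {X. V X \<in> q i})" by (simp add: uncountable_infinite countable_finite)
  moreover have "uncountable (UNIV :: nat set set)" using Cantors_theorem uncountable_def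
    by (metis Pow_UNIV UNIV_not_empty)
  ultimately obtain X where "X \<notin> (\<Union>i. {X. V X \<in> q i})" by (metis UNIV_eq_I)
  moreover have "\<exists>i. q i = x" if "x \<in> C" for x
    using that C(1) by (metis from_nat_into_surj q_def)
  ultimately have "\<forall>x\<in>C. V X \<notin> x" by blast
  then show ?thesis using V(1) by blast
qed

text \<open>The points of \<open>C\<close> not above \<open>F\<close> all miss some
  \<open>h \<in> F\<close> by assumption, and those above \<open>F\<close> all miss some
  \<open>v \<in> p\<close> by separation. The basic open set of \<open>inf h v\<close> contains
  \<open>p\<close> and no point of \<open>C\<close>.\<close>

lemma weak_P_point_stone_space:
  fixes c :: "(nat \<Rightarrow> 'a) \<Rightarrow> 'i"
  assumes "inj c" "infinite (UNIV :: 'i set)"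
    and weak_P_set: "\<And>C. countable C \<Longrightarrow> (\<And>q. q \<in> C \<Longrightarrow> ultrafilter q \<and> \<not> F \<subseteq> q) \<Longrightarrow>
      \<exists>h\<in>F. \<forall>q\<in>C. h \<notin> q"
  shows "\<exists>p. weak_P_point (stone_space :: 'a set topology) p"
proof -
  obtain p where p: "ultrafilter p" "F \<subseteq> p" "\<And>U. decided U p"
    using deciding_ultrafilter[OF assms(1,2)] by blast
  have "p \<notin> stone_space closure_of C" if C: "countable C" "C \<subseteq> topspace stone_space - {p}" for C
  proof -
    have uC: "ultrafilter q \<and> q \<noteq> p" if "q \<in> C" for q
      using C that by (auto simp: topspace_stone_space)
    have countable: "countable {q \<in> C. P q}" for P
      by (rule countable_subset[OF _ C(1)]) blast
    have "\<exists>h\<in>F. \<forall>q\<in>{q \<in> C. \<not> F \<subseteq> q}. h \<notin> q"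
      by (rule weak_P_set[OF countable]) (use uC in blast)
    then obtain h where h: "h \<in> F" "\<And>q. q \<in> C \<Longrightarrow> \<not> F \<subseteq> q \<Longrightarrow> h \<notin> q" by blast
    have "\<exists>v\<in>p. \<forall>q\<in>{q \<in> C. F \<subseteq> q}. v \<notin> q"
      by (rule deciding_ultrafilter_separates[OF p countable]) (use uC in blast)
    then obtain v where v: "v \<in> p" "\<And>q. q \<in> C \<Longrightarrow> F \<subseteq> q \<Longrightarrow> v \<notin> q" by blast
    have hv: "inf h v \<in> p" using p h v by (auto simp: ultrafilter_def)
    define N where "N = {q. ultrafilter q \<and> inf h v \<in> q}"
    have "openin stone_space N"
      unfolding stone_space_def N_def by (rule topology_generated_by_Basis) blast
    moreover have "p \<in> N" using p(1) hv by (simp add: N_def)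
    moreover have "q \<notin> N" if "q \<in> C" for q
    proof
      assume "q \<in> N"
      then have "inf h v \<in> q" by (simp add: N_def)
      moreover have "ultrafilter q" using uC[OF that] by simp
      ultimately have "h \<in> q" "v \<in> q"
        using ultrafilter_upward[OF _ _ inf_le1] ultrafilter_upward[OF _ _ inf_le2] by metis+
      then show False using h(2)[OF that] v(2)[OF that] by (cases "F \<subseteq> q") simp_all
    qed
    ultimately show ?thesis unfolding in_closure_of by metis
  qed
  then show ?thesis using p(1) by (auto simp: weak_P_point_def topspace_stone_space)
qed

end

section \<open>Densities in the measure algebra\<close>

lemma prob_space_haar: "prob_space haar"
proof
  have "emeasure haar {x. \<forall>i\<in>{}. x i = True} = 1"
    by (subst emeasure_haar_cylinder) auto
  then show "emeasure haar (space haar) = 1" by simp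
qed

interpretation haar: prob_space haar by (rule prob_space_haar)

lemma borel_coordinates: "{x :: nat \<Rightarrow> bool. \<forall>i\<in>J. x i \<in> a i} \<in> sets borel"
proof -
  have "open {x :: nat \<Rightarrow> bool. x i \<in> a i}" for i
    using open_vimage[OF discrete_topology_class.open_discrete continuous_on_product_coordinates]
    by (simp add: vimage_def)
  then have "(\<Inter>i\<in>J. {x :: nat \<Rightarrow> bool. x i \<in> a i}) \<in> sets borel"
    by (intro sets.countable_INT'') auto
  moreover have "{x :: nat \<Rightarrow> bool. \<forall>i\<in>J. x i \<in> a i} = (\<Inter>i\<in>J. {x. x i \<in> a i})" by auto
  ultimately show ?thesis by simp
qed

lemma borel_cylinder: "{x :: nat \<Rightarrow> bool. \<forall>i\<in>J. x i = s i} \<in> sets borel"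
  using borel_coordinates[of J "\<lambda>i. {s i}"] by simp

lemma measure_haar_cylinder:
  "finite J \<Longrightarrow> measure haar {x. \<forall>i\<in>J. x i = s i} = (1/2) ^ card J"
  using emeasure_haar_cylinder[of J s] by (simp add: measure_def)

text \<open>The points whose first true even coordinate is \<open>2 * k\<close>, a set of measure
  \<open>(1/2) ^ Suc k\<close>. Odd coordinates stay free, so that conditions on them are
  independent of all pieces.\<close>

definition piece :: "nat \<Rightarrow> (nat \<Rightarrow> bool) set" where
  "piece k = {x. \<forall>j\<in>(*) 2 ` {..k}. x j = (j = 2 * k)}"

lemma piece_borel [measurable, simp]: "piece k \<in> sets borel"
  unfolding piece_def by (rule borel_cylinder)

lemma piece_disjoint:
  assumes "x \<in> piece k" "x \<in> piece l"
  shows "k = l"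
proof -
  have False if "x \<in> piece k" "x \<in> piece l" "k < l" for k l
  proof -
    have "2 * k \<in> (*) 2 ` {..k}" "2 * k \<in> (*) 2 ` {..l}" using that by auto
    then have "x (2 * k) = (2 * k = 2 * k)" "x (2 * k) = (2 * k = 2 * l)"
      using that(1,2) unfolding piece_def by blast+
    then show False using that(3) by simp
  qed
  then show ?thesis using assms by (metis linorder_neqE_nat)
qed

text \<open>The factor is the reciprocal of the measure of \<open>piece k\<close>, so this is the
  conditional probability given that piece.\<close>

lift_definition piece_density :: "nat \<Rightarrow> measure_algebra \<Rightarrow> real"
  is "\<lambda>k A. 2 ^ Suc k * measure haar (A \<inter> piece k)"
proof -
  fix k and A B :: "(nat \<Rightarrow> bool) set"
  assume *: "A \<in> sets borel \<and> B \<in> sets borel \<and> A - B \<union> (B - A) \<in> null_sets haar"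
  then have "AE x in haar. x \<in> A \<inter> piece k \<longleftrightarrow> x \<in> B \<inter> piece k"
    by (intro AE_I'[of "A - B \<union> (B - A)"]) auto
  then have "measure haar (A \<inter> piece k) = measure haar (B \<inter> piece k)"
    using * by (intro measure_eq_AE) (auto simp: sets_haar)
  then show "2 ^ Suc k * measure haar (A \<inter> piece k) = 2 ^ Suc k * measure haar (B \<inter> piece k)"
    by simp
qed

lemma measure_algebra_cases:
  obtains A where "A \<in> sets borel" "b = abs_measure_algebra A"
  by (induction b rule: measure_algebra.abs_induct) auto

lemma abs_measure_algebra_le_iff:
  "A \<in> sets borel \<Longrightarrow> B \<in> sets borel \<Longrightarrow>
    abs_measure_algebra A \<le> abs_measure_algebra B \<longleftrightarrow> A - B \<in> null_sets haar"
  by (simp add: less_eq_measure_algebra.abs_eq eq_onp_def)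

lemma piece_density_abs:
  "A \<in> sets borel \<Longrightarrow>
    piece_density k (abs_measure_algebra A) = 2 ^ Suc k * measure haar (A \<inter> piece k)"
  by (simp add: piece_density.abs_eq eq_onp_def)

lemma inf_abs_measure_algebra:
  "A \<in> sets borel \<Longrightarrow> B \<in> sets borel \<Longrightarrow>
    inf (abs_measure_algebra A) (abs_measure_algebra B) = abs_measure_algebra (A \<inter> B)"
  by (simp add: inf_measure_algebra.abs_eq eq_onp_def)

lemma sup_abs_measure_algebra:
  "A \<in> sets borel \<Longrightarrow> B \<in> sets borel \<Longrightarrow>
    sup (abs_measure_algebra A) (abs_measure_algebra B) = abs_measure_algebra (A \<union> B)"
  by (simp add: sup_measure_algebra.abs_eq eq_onp_def)

lemma uminus_abs_measure_algebra:
  "A \<in> sets borel \<Longrightarrow> - abs_measure_algebra A = abs_measure_algebra (- A)"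
  by (simp add: uminus_measure_algebra.abs_eq eq_onp_def)

lemma abs_measure_algebra_mono:
  "A \<in> sets borel \<Longrightarrow> B \<in> sets borel \<Longrightarrow> A \<subseteq> B \<Longrightarrow>
    abs_measure_algebra A \<le> abs_measure_algebra B"
  by (simp add: abs_measure_algebra_le_iff Diff_eq_empty_iff[THEN iffD2])

text \<open>The intersection of representatives works, since a countable union of null sets is
  null.\<close>

lemma measure_algebra_countable_inf:
  fixes b :: "nat \<Rightarrow> measure_algebra"
  shows "\<exists>g. (\<forall>n. g \<le> b n) \<and> (\<forall>u. (\<forall>n. u \<le> b n) \<longrightarrow> u \<le> g)"
proof -
  have "\<exists>B. B \<in> sets borel \<and> b n = abs_measure_algebra B" for n
    using measure_algebra_cases[of "b n"] by blast
  then obtain B where B: "\<And>n. B n \<in> sets borel" "\<And>n. b n = abs_measure_algebra (B n)"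
    by metis
  have I: "(\<Inter>n. B n) \<in> sets borel" using B by auto
  have "abs_measure_algebra (\<Inter>n. B n) \<le> b n" for n
    using B I by (auto intro: abs_measure_algebra_mono)
  moreover have "u \<le> abs_measure_algebra (\<Inter>n. B n)" if u: "\<forall>n. u \<le> b n" for u
  proof -
    obtain A where A: "A \<in> sets borel" "u = abs_measure_algebra A" by (rule measure_algebra_cases)
    have "A - B n \<in> null_sets haar" for n
      using u A B by (simp add: abs_measure_algebra_le_iff)
    then have "(\<Union>n. A - B n) \<in> null_sets haar" by (rule null_sets_UN)
    moreover have "(\<Union>n. A - B n) = A - (\<Inter>n. B n)" by blast
    ultimately have "A - (\<Inter>n. B n) \<in> null_sets haar" by (rule back_subst)
    then show ?thesis unfolding A(2) abs_measure_algebra_le_iff[OF A(1) I] .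
  qed
  ultimately show ?thesis by (intro exI[of _ "abs_measure_algebra (\<Inter>n. B n)"]) simp
qed

lemma piece_density_nonneg: "0 \<le> piece_density k b"
  by transfer simp

lemma piece_density_bot: "piece_density k bot = 0"
  by transfer simp

lemma piece_density_mono:
  assumes "a \<le> b"
  shows "piece_density k a \<le> piece_density k b"
proof -
  obtain A where A: "A \<in> sets borel" "a = abs_measure_algebra A" by (rule measure_algebra_cases)
  obtain B where B: "B \<in> sets borel" "b = abs_measure_algebra B" by (rule measure_algebra_cases)
  have "A - B \<in> null_sets haar" using assms A B by (simp add: abs_measure_algebra_le_iff)
  then have "AE x in haar. x \<in> A \<inter> piece k \<longrightarrow> x \<in> B \<inter> piece k"
    by (intro AE_I'[of "A - B"]) auto
  then have "measure haar (A \<inter> piece k) \<le> measure haar (B \<inter> piece k)"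
    using A B by (intro haar.finite_measure_mono_AE) (auto simp: sets_haar)
  then show ?thesis using A B by (simp add: piece_density_abs)
qed

lemma piece_density_sup_le: "piece_density k (sup a b) \<le> piece_density k a + piece_density k b"
proof -
  obtain A where A: "A \<in> sets borel" "a = abs_measure_algebra A" by (rule measure_algebra_cases)
  obtain B where B: "B \<in> sets borel" "b = abs_measure_algebra B" by (rule measure_algebra_cases)
  have "measure haar ((A \<inter> piece k) \<union> (B \<inter> piece k))
      \<le> measure haar (A \<inter> piece k) + measure haar (B \<inter> piece k)"
    using A B by (intro measure_subadditive) (auto simp: sets_haar)
  then show ?thesis
    using A B by (simp add: piece_density_abs sup_abs_measure_algebra Int_Un_distrib2 flip: distrib_left)
qed

text \<open>The class of the union of representatives serves, by countable subadditivity inside each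
  piece. The summability guard excludes the arbitrary value of a divergent series.\<close>

lemma piece_density_countable_upper_bound:
  fixes b :: "nat \<Rightarrow> measure_algebra"
  shows "\<exists>u. (\<forall>i. b i \<le> u) \<and>
    (\<forall>k. summable (\<lambda>i. piece_density k (b i)) \<longrightarrow> piece_density k u \<le> (\<Sum>i. piece_density k (b i)))"
proof -
  have "\<exists>B. B \<in> sets borel \<and> b n = abs_measure_algebra B" for n
    using measure_algebra_cases[of "b n"] by blast
  then obtain B where B: "\<And>n. B n \<in> sets borel" "\<And>n. b n = abs_measure_algebra (B n)"
    by metis
  have U: "(\<Union>n. B n) \<in> sets borel" using B by auto
  have "b n \<le> abs_measure_algebra (\<Union>n. B n)" for n
    using B U by (auto intro: abs_measure_algebra_mono)
  moreover have "piece_density k (abs_measure_algebra (\<Union>n. B n)) \<le> (\<Sum>i. piece_density k (b i))"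
    if "summable (\<lambda>i. piece_density k (b i))" for k
  proof -
    have sm: "summable (\<lambda>i. measure haar (B i \<inter> piece k))"
      using that B by (simp add: piece_density_abs)
    have "measure haar (\<Union>n. B n \<inter> piece k) \<le> (\<Sum>i. measure haar (B i \<inter> piece k))"
      by (rule haar.finite_measure_subadditive_countably[OF _ sm]) (use B(1) in \<open>auto simp: sets_haar\<close>)
    moreover have "(\<Union>n. B n \<inter> piece k) = (\<Union>n. B n) \<inter> piece k" by blast
    ultimately have "measure haar ((\<Union>n. B n) \<inter> piece k) \<le> (\<Sum>i. measure haar (B i \<inter> piece k))"
      by simp
    then have "2 ^ Suc k * measure haar ((\<Union>n. B n) \<inter> piece k)
        \<le> (\<Sum>i. 2 ^ Suc k * measure haar (B i \<inter> piece k))"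
      unfolding suminf_mult[OF sm] by (rule mult_left_mono) simp
    then show ?thesis using B by (simp only: piece_density_abs[OF U] piece_density_abs)
  qed
  ultimately show ?thesis by (intro exI[of _ "abs_measure_algebra (\<Union>n. B n)"]) simp
qed

section \<open>Unions of pieces and the density-one filter\<close>

definition chunk :: "nat set \<Rightarrow> measure_algebra" where
  "chunk D = abs_measure_algebra (\<Union>k\<in>D. piece k)"

lemma borel_chunk: "(\<Union>k\<in>D. piece k) \<in> sets borel"
  by (intro sets.countable_UN') auto

lemma inf_chunk: "inf (chunk D) (chunk D') = chunk (D \<inter> D')"
proof -
  have "(\<Union>k\<in>D. piece k) \<inter> (\<Union>k\<in>D'. piece k) = (\<Union>k\<in>D \<inter> D'. piece k)"
    using piece_disjoint by blast
  then show ?thesis unfolding chunk_def by (simp add: inf_abs_measure_algebra borel_chunk)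
qed

lemma chunk_mono: "D \<subseteq> D' \<Longrightarrow> chunk D \<le> chunk D'"
  by (metis inf.absorb_iff1 inf_chunk)

lemma le_chunk_INT:
  assumes "finite S" "S \<noteq> {}" "\<And>X. X \<in> S \<Longrightarrow> z \<le> chunk (D X)"
  shows "z \<le> chunk (\<Inter>X\<in>S. D X)"
  using assms by (induction rule: finite_ne_induct) (simp_all flip: inf_chunk)

lemma measure_piece: "measure haar (piece k) = (1/2) ^ Suc k"
  unfolding piece_def by (subst measure_haar_cylinder) (simp_all add: card_image inj_on_def)

lemma piece_density_chunk: "piece_density k (chunk D) = (if k \<in> D then 1 else 0)"
proof -
  have "(\<Union>k\<in>D. piece k) \<inter> piece k = (if k \<in> D then piece k else {})"
    using piece_disjoint by auto
  then show ?thesis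
    by (simp add: chunk_def piece_density_abs borel_chunk measure_piece power_one_over del: power_Suc)
qed

text \<open>Formulated with complements, so that closure under meets becomes subadditivity of the
  density.\<close>

definition density_one_filter :: "measure_algebra set" where
  "density_one_filter = {b. (\<lambda>k. piece_density k (- b)) \<longlonglongrightarrow> 0}"

lemma tendsto_zero_density_mono:
  assumes "(\<lambda>k. piece_density k b) \<longlonglongrightarrow> 0" "a \<le> b"
  shows "(\<lambda>k. piece_density k a) \<longlonglongrightarrow> 0"
  by (rule tendsto_sandwich[OF _ _ tendsto_const assms(1)])
    (simp_all add: piece_density_nonneg piece_density_mono assms(2))

lemma lattice_filter_density_one: "lattice_filter density_one_filter"
  unfolding lattice_filter_def
proof (intro conjI ballI allI impI)
  show "top \<in> density_one_filter" by (simp add: density_one_filter_def piece_density_bot)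
  show "inf a b \<in> density_one_filter" if "a \<in> density_one_filter" "b \<in> density_one_filter" for a b
  proof -
    have *: "(\<lambda>k. piece_density k (- a) + piece_density k (- b)) \<longlonglongrightarrow> 0"
      using tendsto_add that unfolding density_one_filter_def by fastforce
    have "(\<lambda>k. piece_density k (sup (- a) (- b))) \<longlonglongrightarrow> 0"
      by (rule tendsto_sandwich[OF _ _ tendsto_const *]) (simp_all add: piece_density_nonneg piece_density_sup_le)
    then show ?thesis by (simp add: density_one_filter_def)
  qed
  show "b \<in> density_one_filter" if "a \<in> density_one_filter" "a \<le> b" for a b
    using that tendsto_zero_density_mono[of "- a" "- b"] by (simp add: density_one_filter_def)
qed

text \<open>An ultrafilter picks a value at each of the first \<open>n\<close> odd coordinates.
  Pieces restrict only even coordinates, so the resulting cylinder is independent of them and has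
  density \<open>(1/2) ^ n\<close> in each.\<close>

lemma ultrafilter_uniformly_small:
  assumes "ultrafilter q"
  shows "\<exists>b\<in>q. \<forall>k. piece_density k b \<le> (1/2) ^ n"
proof -
  define W where "W = (\<lambda>n. (\<lambda>i::nat. Suc (2 * i)) ` {..<n})"
  define Q where "Q = (\<lambda>n s. {x :: nat \<Rightarrow> bool. \<forall>j\<in>W n. x j = s j})"
  have Q: "Q n s \<in> sets borel" for n s unfolding Q_def by (rule borel_cylinder)
  have "\<exists>s. abs_measure_algebra (Q n s) \<in> q"
  proof (induction n)
    case 0
    have "abs_measure_algebra UNIV \<in> q"
      using assms by (simp add: ultrafilter_def flip: top_measure_algebra_def)
    then show ?case by (simp add: Q_def W_def)
  next
    case (Suc n)
    then obtain s where s: "abs_measure_algebra (Q n s) \<in> q" by blast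
    define H where "H = {x :: nat \<Rightarrow> bool. \<forall>j\<in>{Suc (2 * n)}. x j = True}"
    have H: "H \<in> sets borel" unfolding H_def by (rule borel_cylinder)
    have "abs_measure_algebra H \<in> q \<or> abs_measure_algebra (- H) \<in> q"
      using assms H by (metis ultrafilter_def uminus_abs_measure_algebra)
    then obtain c where c: "abs_measure_algebra (if c then H else - H) \<in> q" by (metis (full_types))
    define K where "K = (if c then H else - H)"
    have K: "K \<in> sets borel" using H by (simp add: K_def)
    have "inf (abs_measure_algebra (Q n s)) (abs_measure_algebra K) \<in> q"
      using s c assms by (simp add: ultrafilter_def K_def)
    then have "abs_measure_algebra (Q n s \<inter> K) \<in> q"
      using Q K by (simp add: inf_abs_measure_algebra)
    moreover have "Q n s \<inter> K = Q (Suc n) (s(Suc (2 * n) := c))"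
      by (auto simp: Q_def W_def K_def H_def lessThan_Suc)
    ultimately show ?case by metis
  qed
  then obtain s where s: "abs_measure_algebra (Q n s) \<in> q" by blast
  have "piece_density k (abs_measure_algebra (Q n s)) = (1/2) ^ n" for k
  proof -
    define P where "P = (*) 2 ` {..k}"
    \<comment> \<open>\<open>t\<close> merges \<open>s\<close> on the odd coordinates with the
      pattern of \<open>piece k\<close> on the even ones, so that the intersection is one cylinder
      with \<open>n + Suc k\<close> conditions.\<close>
    define t where "t = (\<lambda>j. if even j then j = 2 * k else s j)"
    have fin: "finite (W n \<union> P)" by (simp add: P_def W_def)
    have odd: "odd j" if "j \<in> W n" for j using that by (auto simp: W_def)
    have even: "even j" if "j \<in> P" for j using that by (auto simp: P_def)
    have "t j = s j" if "j \<in> W n" for j using odd[OF that] by (simp add: t_def)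
    moreover have "t j = (j = 2 * k)" if "j \<in> P" for j using even[OF that] by (simp add: t_def)
    moreover have "piece k = {x. \<forall>j\<in>P. x j = (j = 2 * k)}" by (simp only: piece_def P_def)
    ultimately have "Q n s \<inter> piece k = {x. \<forall>j\<in>W n \<union> P. x j = t j}"
      by (auto simp: Q_def)
    moreover have "card (W n \<union> P) = n + Suc k"
    proof -
      have "W n \<inter> P = {}" using odd even by blast
      then have "card (W n \<union> P) = card (W n) + card P"
        using fin by (intro card_Un_disjoint) simp_all
      then show ?thesis by (simp add: W_def P_def card_image inj_on_def)
    qed
    ultimately have "measure haar (Q n s \<inter> piece k) = (1/2) ^ (n + Suc k)"
      using measure_haar_cylinder[OF fin] by simp
    then have "piece_density k (abs_measure_algebra (Q n s)) = 2 ^ Suc k * (1/2) ^ (n + Suc k)"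
      by (simp only: piece_density_abs[OF Q])
    then show ?thesis by (simp add: power_add field_simps)
  qed
  then show ?thesis using s by (intro bexI[of _ "abs_measure_algebra (Q n s)"]) auto
qed

lemma density_one_filter_weak_P_set:
  assumes "countable C" and C: "\<And>q. q \<in> C \<Longrightarrow> ultrafilter q \<and> \<not> density_one_filter \<subseteq> q"
  shows "\<exists>h\<in>density_one_filter. \<forall>q\<in>C. h \<notin> q"
proof (cases "C = {}")
  case True
  then show ?thesis using lattice_filter_density_one by (auto simp: lattice_filter_def)
next
  case False
  define q where "q = from_nat_into C"
  have "q i \<in> C" for i using False by (simp add: q_def from_nat_into)
  then have q: "ultrafilter (q i)" "\<not> density_one_filter \<subseteq> q i" for i using C by blast+
  \<comment> \<open>The complement of a filter element missing from \<open>q i\<close> has density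
    tending to 0; its meet with a uniformly small element also obeys the bound
    \<open>(1/2) ^ i\<close>, which controls the join over all \<open>i\<close>.\<close>
  have "\<exists>b. b \<in> q i \<and> (\<lambda>k. piece_density k b) \<longlonglongrightarrow> 0 \<and> (\<forall>k. piece_density k b \<le> (1/2) ^ i)" for i
  proof -
    obtain f where f: "f \<in> density_one_filter" "f \<notin> q i" using q(2) by blast
    then have "- f \<in> q i" using ultrafilter_uminus[OF q(1)] by blast
    moreover obtain b where b: "b \<in> q i" "\<And>k. piece_density k b \<le> (1/2) ^ i"
      using ultrafilter_uniformly_small[OF q(1)] by blast
    ultimately have "inf (- f) b \<in> q i" using q(1)[of i] by (simp add: ultrafilter_def)
    moreover have "(\<lambda>k. piece_density k (inf (- f) b)) \<longlonglongrightarrow> 0"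
      using f(1) by (auto simp: density_one_filter_def intro: tendsto_zero_density_mono)
    moreover have "piece_density k (inf (- f) b) \<le> (1/2) ^ i" for k
      using piece_density_mono[of "inf (- f) b" b k] b(2)[of k] by simp
    ultimately show ?thesis by blast
  qed
  then obtain b where b: "\<And>i. b i \<in> q i" "\<And>i. (\<lambda>k. piece_density k (b i)) \<longlonglongrightarrow> 0"
    "\<And>i k. piece_density k (b i) \<le> (1/2) ^ i" by metis
  obtain u where u: "\<And>i. b i \<le> u" "\<And>k. summable (\<lambda>i. piece_density k (b i)) \<Longrightarrow>
      piece_density k u \<le> (\<Sum>i. piece_density k (b i))"
    using piece_density_countable_upper_bound by metis
  have "summable (\<lambda>i. (1/2 :: real) ^ i)" by (simp add: summable_geometric)
  then have "summable (\<lambda>i. piece_density k (b i))" for k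
    by (rule summable_comparison_test'[where N = 0]) (simp add: b(3) piece_density_nonneg)
  then have le: "piece_density k u \<le> (\<Sum>i. piece_density k (b i))" for k by (rule u(2))
  have "\<forall>\<^sub>F (i, k) in at_top \<times>\<^sub>F sequentially. norm (piece_density k (b i)) \<le> (1/2) ^ i"
    by (rule always_eventually) (simp add: b(3) piece_density_nonneg split_beta)
  \<comment> \<open>The bounds \<open>(1/2) ^ i\<close> dominate the series uniformly in
    \<open>k\<close>, so by Tannery's theorem the limit in \<open>k\<close> may be taken
    termwise.\<close>
  then have "(\<lambda>k. \<Sum>i. piece_density k (b i)) \<longlonglongrightarrow> (\<Sum>i. 0)"
    using tannerys_theorem[OF b(2)] \<open>summable (\<lambda>i. (1/2 :: real) ^ i)\<close> by simp
  then have *: "(\<lambda>k. \<Sum>i. piece_density k (b i)) \<longlonglongrightarrow> 0" by simp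
  have "(\<lambda>k. piece_density k u) \<longlonglongrightarrow> 0"
    by (rule tendsto_sandwich[OF _ _ tendsto_const *]) (simp_all add: piece_density_nonneg le)
  then have "- u \<in> density_one_filter" by (simp add: density_one_filter_def)
  moreover have "- u \<notin> x" if x: "x \<in> C" for x
  proof -
    obtain i where "q i = x" using x assms(1) by (metis from_nat_into_surj q_def)
    then have "u \<in> x" "ultrafilter x" using b(1)[of i] u(1)[of i] q(1)[of i]
      by (auto simp: ultrafilter_def)
    then show ?thesis using ultrafilter_uminus by blast
  qed
  ultimately show ?thesis by blast
qed

text \<open>
  An element is determined by its traces on the countably many sets given by conditions on finitely
  many coordinates; this bounds the number of sequences of elements by the continuum.
\<close>

lift_definition coord_measure :: "(nat \<times> bool set) list \<Rightarrow> measure_algebra \<Rightarrow> real"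
  is "\<lambda>l A. measure haar (A \<inter> {x. \<forall>(i, a)\<in>set l. x i \<in> a})"
proof -
  fix l :: "(nat \<times> bool set) list" and A B :: "(nat \<Rightarrow> bool) set"
  let ?L = "{x :: nat \<Rightarrow> bool. \<forall>(i, a)\<in>set l. x i \<in> a}"
  assume *: "A \<in> sets borel \<and> B \<in> sets borel \<and> A - B \<union> (B - A) \<in> null_sets haar"
  \<comment> \<open>\<open>l\<close> may list a coordinate repeatedly; the conditions on one
    coordinate are merged into a single set.\<close>
  have "{x :: nat \<Rightarrow> bool. \<forall>i\<in>UNIV. x i \<in> {v. \<forall>a. (i, a) \<in> set l \<longrightarrow> v \<in> a}} \<in> sets borel"
    by (rule borel_coordinates)
  moreover have "{x :: nat \<Rightarrow> bool. \<forall>i\<in>UNIV. x i \<in> {v. \<forall>a. (i, a) \<in> set l \<longrightarrow> v \<in> a}} = ?L"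
    by auto
  ultimately have L: "?L \<in> sets borel" by simp
  have "AE x in haar. x \<in> A \<inter> ?L \<longleftrightarrow> x \<in> B \<inter> ?L"
    by (rule AE_I'[of "A - B \<union> (B - A)"]) (use * in auto)
  then show "measure haar (A \<inter> ?L) = measure haar (B \<inter> ?L)"
    by (rule measure_eq_AE) (use * L in \<open>auto simp: sets_haar\<close>)
qed

lemma coord_measure_abs:
  "A \<in> sets borel \<Longrightarrow> coord_measure l (abs_measure_algebra A) =
    measure haar (A \<inter> {x. \<forall>(i, a)\<in>set l. x i \<in> a})"
  by (simp add: coord_measure.abs_eq eq_onp_def)

text \<open>The restrictions of \<open>haar\<close> to \<open>A\<close> and to \<open>B\<close> are
  finite measures that agree on cylinders, hence equal; evaluated at \<open>A - B\<close>, this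
  makes \<open>A - B\<close> null.\<close>

lemma coord_measure_le:
  assumes "\<And>l. coord_measure l a = coord_measure l b"
  shows "a \<le> b"
proof -
  obtain A where A: "A \<in> sets borel" "a = abs_measure_algebra A" by (rule measure_algebra_cases)
  obtain B where B: "B \<in> sets borel" "b = abs_measure_algebra B" by (rule measure_algebra_cases)
  have A': "A \<in> sets haar" and B': "B \<in> sets haar" using A B by (simp_all add: sets_haar)
  have "density haar (indicator A) = density haar (indicator B)"
    (is "?P = ?Q")
  proof (rule measure_eqI_PiM_infinite)
    show "sets ?P = sets (\<Pi>\<^sub>M i\<in>UNIV. uniform_count_measure (UNIV :: bool set))"
      "sets ?Q = sets (\<Pi>\<^sub>M i\<in>UNIV. uniform_count_measure (UNIV :: bool set))"
      by (simp_all add: haar_def)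
    show "finite_measure ?P" using A' by (rule haar.finite_measure_restricted)
    fix a :: "nat \<Rightarrow> bool set" and J :: "nat set"
    assume J: "finite J"
    define l where "l = map (\<lambda>i. (i, a i)) (sorted_list_of_set J)"
    define L where "L = {x :: nat \<Rightarrow> bool. \<forall>(i, a)\<in>set l. x i \<in> a}"
    have L: "L = {x. \<forall>i\<in>J. x i \<in> a i}" using J by (simp add: L_def l_def)
    have emb: "prod_emb UNIV (\<lambda>_. uniform_count_measure (UNIV :: bool set)) J (Pi\<^sub>E J a) = L"
      unfolding L by (auto simp: prod_emb_def space_uniform_count_measure restrict_PiE_iff)
    have "L \<in> sets haar" unfolding L sets_haar by (rule borel_coordinates)
    moreover have "measure haar (A \<inter> L) = measure haar (B \<inter> L)"
      using assms[of l] A B unfolding L_def by (simp add: coord_measure_abs)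
    ultimately have "emeasure ?P L = emeasure ?Q L"
      using A' B' by (simp add: emeasure_restricted haar.emeasure_eq_measure)
    then show "emeasure ?P (prod_emb UNIV (\<lambda>_. uniform_count_measure (UNIV :: bool set)) J (Pi\<^sub>E J a))
        = emeasure ?Q (prod_emb UNIV (\<lambda>_. uniform_count_measure (UNIV :: bool set)) J (Pi\<^sub>E J a))"
      by (simp only: emb)
  qed
  then have "emeasure ?P (A - B) = emeasure ?Q (A - B)" by simp
  moreover have "A \<inter> (A - B) = A - B" "B \<inter> (A - B) = {}" by auto
  ultimately have "emeasure haar (A - B) = 0"
    using A' B' by (simp add: emeasure_restricted)
  then show ?thesis using A B A' B' by (simp add: abs_measure_algebra_le_iff null_sets_def)
qed

text \<open>\<open>c U\<close> codes, for all \<open>n\<close> and \<open>l\<close>, the rationals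
  below \<open>coord_measure l (U n)\<close>: there are countably many triples, and the cuts
  determine the reals.\<close>

lemma inj_measure_algebra_sequences:
  "\<exists>c :: (nat \<Rightarrow> measure_algebra) \<Rightarrow> nat set. inj c"
proof -
  define c where "c = (\<lambda>U :: nat \<Rightarrow> measure_algebra.
    to_nat ` {(n, l, r :: rat). real_of_rat r < coord_measure l (U n)})"
  have "U n \<le> U' n" if "c U = c U'" for U U' n
  proof (rule coord_measure_le)
    fix l
    have "{(n, l, r :: rat). real_of_rat r < coord_measure l (U n)} =
        {(n, l, r). real_of_rat r < coord_measure l (U' n)}"
      using that unfolding c_def by (simp only: inj_image_eq_iff[OF inj_to_nat])
    then have *: "real_of_rat r < coord_measure l (U n) \<longleftrightarrow> real_of_rat r < coord_measure l (U' n)" for r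
      by (auto simp: set_eq_iff)
    show "coord_measure l (U n) = coord_measure l (U' n)"
      using * of_rat_dense by (metis less_asym linorder_neqE_linordered_idom)
  qed
  then have "inj c" by (intro injI ext antisym) simp_all
  then show ?thesis by blast
qed

section \<open>The matrix in the measure algebra\<close>

lemma linked_matrix_chunk:
  assumes "\<And>Y X. mono (\<alpha> Y X)"
    and "\<And>Y S n. card S = Suc n \<Longrightarrow> finite (\<Inter>X\<in>S. \<alpha> Y X n)"
    and "\<And>T. finite T \<Longrightarrow> infinite (\<Inter>(Y, X)\<in>T. \<alpha> Y X (card (T `` {Y})))"
  shows "linked_matrix density_one_filter (\<lambda>Y X n. chunk (\<alpha> Y X n))
    (\<lambda>T. chunk (\<Inter>(Y, X)\<in>T. \<alpha> Y X (card (T `` {Y}))))"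
proof
  show "lattice_filter density_one_filter" by (rule lattice_filter_density_one)
  show "mono (\<lambda>n. chunk (\<alpha> Y X n))" for Y X
    using assms(1) by (intro monoI chunk_mono) (rule monoD)
  show "\<exists>h\<in>density_one_filter. \<forall>z\<le>h. (\<forall>X\<in>S. z \<le> chunk (\<alpha> Y X k)) \<longrightarrow> z = bot"
    if S: "card S = Suc k" for Y S k
  proof (intro bexI allI impI)
    let ?D = "\<Inter>X\<in>S. \<alpha> Y X k"
    \<comment> \<open>The witness is the complement of \<open>chunk ?D\<close>: as \<open>?D\<close>
      is finite, \<open>chunk ?D\<close> has density 0 in almost all pieces.\<close>
    fix z assume z: "z \<le> - chunk ?D" "\<forall>X\<in>S. z \<le> chunk (\<alpha> Y X k)"
    have "finite S" "S \<noteq> {}" using S card.infinite by fastforce+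
    then have "z \<le> chunk ?D" using z(2) by (intro le_chunk_INT) simp_all
    then have "z \<le> inf (chunk ?D) (- chunk ?D)" using z(1) by (rule inf_greatest)
    then show "z = bot" by (simp add: le_bot)
  next
    have "finite (\<Inter>X\<in>S. \<alpha> Y X k)" by (rule assms(2)[OF S])
    then have "\<forall>\<^sub>F n in sequentially. n \<notin> (\<Inter>X\<in>S. \<alpha> Y X k)"
      unfolding cofinite_eq_sequentially[symmetric] eventually_cofinite not_not Collect_mem_eq .
    then have "\<forall>\<^sub>F n in sequentially. piece_density n (chunk (\<Inter>X\<in>S. \<alpha> Y X k)) = 0"
      by eventually_elim (simp add: piece_density_chunk)
    then show "- chunk (\<Inter>X\<in>S. \<alpha> Y X k) \<in> density_one_filter"
      unfolding density_one_filter_def by (simp add: tendsto_eventually)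
  qed
  show "chunk (\<Inter>(Y', X)\<in>{Y} \<times> S. \<alpha> Y' X (card (({Y} \<times> S) `` {Y'}))) \<le> chunk (\<alpha> Y X (card S))"
    if "X \<in> S" for X S Y
  proof (rule chunk_mono)
    have "({Y} \<times> S) `` {Y} = S" by auto
    then show "(\<Inter>(Y', X)\<in>{Y} \<times> S. \<alpha> Y' X (card (({Y} \<times> S) `` {Y'}))) \<subseteq> \<alpha> Y X (card S)"
      using that by auto
  qed
  show "chunk (\<Inter>(Y, X)\<in>T \<union> T'. \<alpha> Y X (card ((T \<union> T') `` {Y}))) =
      inf (chunk (\<Inter>(Y, X)\<in>T. \<alpha> Y X (card (T `` {Y}))))
        (chunk (\<Inter>(Y, X)\<in>T'. \<alpha> Y X (card (T' `` {Y}))))"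
    if "Domain T \<inter> Domain T' = {}" for T T'
  proof -
    have "(T \<union> T') `` {Y} = T `` {Y}" if "(Y, X) \<in> T" for X Y
      using that \<open>Domain T \<inter> Domain T' = {}\<close> by blast
    moreover have "(T \<union> T') `` {Y} = T' `` {Y}" if "(Y, X) \<in> T'" for X Y
      using that \<open>Domain T \<inter> Domain T' = {}\<close> by blast
    ultimately have "(\<Inter>(Y, X)\<in>T \<union> T'. \<alpha> Y X (card ((T \<union> T') `` {Y}))) =
        (\<Inter>(Y, X)\<in>T. \<alpha> Y X (card (T `` {Y}))) \<inter> (\<Inter>(Y, X)\<in>T'. \<alpha> Y X (card (T' `` {Y})))"
      unfolding INF_union by (intro arg_cong2[of _ _ _ _ "(\<inter>)"] INF_cong) auto
    then show ?thesis by (simp only: inf_chunk)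
  qed
  show "inf f (chunk (\<Inter>(Y, X)\<in>T. \<alpha> Y X (card (T `` {Y})))) \<noteq> bot"
    if f: "f \<in> density_one_filter" and T: "finite T" for f T
  proof
    let ?D = "\<Inter>(Y, X)\<in>T. \<alpha> Y X (card (T `` {Y}))"
    assume "inf f (chunk ?D) = bot"
    then have "inf (chunk ?D) f = bot" by (simp only: inf.commute)
    then have "chunk ?D \<le> - f" by (simp only: inf_shunt)
    \<comment> \<open>\<open>chunk ?D\<close> has density 1 in the pieces indexed by
      \<open>?D\<close>, whereas \<open>- f\<close> has density below 1 in almost all pieces, so
      \<open>?D\<close> would be finite.\<close>
    then have le: "piece_density k (chunk ?D) \<le> piece_density k (- f)" for k
      by (rule piece_density_mono)
    have "\<forall>\<^sub>F k in sequentially. piece_density k (- f) < 1"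
      using f order_tendstoD(2)[of "\<lambda>k. piece_density k (- f)" 0 sequentially 1] by (simp add: density_one_filter_def)
    then have "\<forall>\<^sub>F k in cofinite. k \<notin> ?D"
      unfolding cofinite_eq_sequentially
    proof eventually_elim
      case (elim k)
      then have "piece_density k (chunk ?D) \<noteq> 1" using le[of k] by linarith
      then show "k \<notin> ?D" using piece_density_chunk[of k ?D] by metis
    qed
    then have "finite ?D" unfolding eventually_cofinite not_not Collect_mem_eq .
    then show False using assms(3)[OF T] by blast
  qed
  show "\<exists>g. (\<forall>n. g \<le> b n) \<and> (\<forall>u. (\<forall>n. u \<le> b n) \<longrightarrow> u \<le> g)" for b :: "nat \<Rightarrow> measure_algebra"
    by (rule measure_algebra_countable_inf)
qed

theorem theorem4p7:
  shows "\<exists>p. weak_P_point (stone_space :: measure_algebra set topology) p"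
proof (rule independent_linked_matrix_exists)
  fix \<alpha> :: "nat set \<Rightarrow> nat set \<Rightarrow> nat \<Rightarrow> nat set"
  assume \<alpha>: "\<And>Y X. mono (\<alpha> Y X)"
    "\<And>Y S n. card S = Suc n \<Longrightarrow> finite (\<Inter>X\<in>S. \<alpha> Y X n)"
    "\<And>T. finite T \<Longrightarrow> infinite (\<Inter>(Y, X)\<in>T. \<alpha> Y X (card (T `` {Y})))"
  interpret linked_matrix density_one_filter "\<lambda>Y X n. chunk (\<alpha> Y X n)"
    "\<lambda>T. chunk (\<Inter>(Y, X)\<in>T. \<alpha> Y X (card (T `` {Y})))"
    using \<alpha> by (rule linked_matrix_chunk)
  \<comment> \<open>Rows are indexed by sets of naturals, so this injection provides at least as
    many rows as there are sequences to decide.\<close>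
  obtain c :: "(nat \<Rightarrow> measure_algebra) \<Rightarrow> nat set" where "inj c"
    using inj_measure_algebra_sequences by blast
  moreover have "infinite (UNIV :: nat set set)" by (simp add: Finite_Set.finite_set)
  ultimately show ?thesis
    using density_one_filter_weak_P_set by (rule weak_P_point_stone_space)
qed

end
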